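(* Let $G=([n],E)$ be a finite simple graph with $E\neq\emptyset$. Then the symmetric edge polytope $\mathcal{P}_G$ is a simple polytope if and only if, after removing isolated vertices, $G$ is isomorphic to one of the graphs $P_1$, $2P_1$, $P_2$, $C_3$, $C_4$.
   Context: For a finite simple graph $G=([n],E)$, the symmetric edge polytope is $\mathcal{P}_G=\mathrm{conv}(\pm(e_i-e_j) : ij\in E)\subset\mathbb{R}^n$. $P_m$ denotes the path with $m$ edges (and $m+1$ vertices), $2P_1$ is the disjoint union of two edges, and $C_m$ is the cycle with $m$ vertices. A $d$-dimensional polytope is simple if every vertex is contained in exactly $d$ edges. *)

theory Defs
  imports "HOL-Analysis.Analysis"
begin

record 'a graph =
  verts :: "'a set"
  edges :: "'a set set"

definition finite_simple_graph :: "'a graph \<Rightarrow> bool" where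
  "finite_simple_graph G \<longleftrightarrow>
     finite (verts G) \<and> (\<forall>e \<in> edges G. e \<subseteq> verts G \<and> card e = 2)"

definition graph_isomorphic :: "'a graph \<Rightarrow> 'b graph \<Rightarrow> bool" (infix "\<simeq>\<^sub>g" 50) where
  "G \<simeq>\<^sub>g H \<longleftrightarrow>
     (\<exists>f. bij_betw f (verts G) (verts H) \<and>
          (\<forall>u \<in> verts G. \<forall>v \<in> verts G. {u, v} \<in> edges G \<longleftrightarrow> {f u, f v} \<in> edges H))"

definition remove_isolated :: "'a graph \<Rightarrow> 'a graph" where
  "remove_isolated G =
     \<lparr> verts = {v \<in> verts G. \<exists>e \<in> edges G. v \<in> e}, edges = edges G \<rparr>"

text \<open>Paths are indexed by their number of edges: \<open>path_graph m\<close> has \<open>m + 1\<close> vertices.\<close>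

definition path_graph :: "nat \<Rightarrow> nat graph" where
  "path_graph m = \<lparr> verts = {0..m}, edges = {{i, i + 1} | i. i < m} \<rparr>"

text \<open>Cycles are indexed by their number of vertices; meant only for \<open>m \<ge> 3\<close>.\<close>

definition cycle_graph :: "nat \<Rightarrow> nat graph" where
  "cycle_graph m = \<lparr> verts = {0..<m}, edges = {{i, (i + 1) mod m} | i. i < m} \<rparr>"

definition disjoint_union :: "'a graph \<Rightarrow> 'b graph \<Rightarrow> ('a + 'b) graph" where
  "disjoint_union G H =
     \<lparr> verts = verts G <+> verts H,
       edges = (\<lambda>e. Inl ` e) ` edges G \<union> (\<lambda>e. Inr ` e) ` edges H \<rparr>"

text \<open>Since \<open>{i, j} = {j, i}\<close>, each edge contributes both of the points
  \<open>e\<^sub>i - e\<^sub>j\<close> and \<open>e\<^sub>j - e\<^sub>i\<close>.\<close>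

definition symmetric_edge_polytope :: "'n::finite graph \<Rightarrow> (real ^ 'n) set" where
  "symmetric_edge_polytope G = convex hull {axis i 1 - axis j 1 | i j. {i, j} \<in> edges G}"

text \<open>The dimension is that of the affine hull, so \<open>P\<close> need not be full-dimensional.\<close>

definition simple_polytope :: "'a::euclidean_space set \<Rightarrow> bool" where
  "simple_polytope P \<longleftrightarrow>
     polytope P \<and>
     (\<forall>v. v extreme_point_of P \<longrightarrow> int (card {F. F edge_of P \<and> v \<in> F}) = aff_dim P)"

end

theory Submission
  imports Defs
begin

text \<open>
  Write \<open>arc_vec (i, j)\<close> for \<open>e\<^sub>i - e\<^sub>j\<close>. Each arc of \<open>G\<close> gives a different vertex of the polytope,
  so simplicity says that every arc \<open>(i, j)\<close> has exactly as many neighbours in the 1-skeleton as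
  the dimension of the span of all the vectors \<open>arc_vec a\<close>.

  The 1-skeleton can be read off from the graph. Two vertices \<open>v\<close>, \<open>w\<close> fail to be joined by an edge
  as soon as \<open>v + w\<close> is the sum of two other points of the polytope, one of them a vertex:
  a second antipodal pair, the third side of a triangle, or the other half of a 4-cycle supplies
  such an exchange (\<open>not_spans_edge_if_exchange\<close>). If no exchange exists, an explicit potential on
  the nodes, that is, a linear functional, attains its maximum over the vertices exactly at \<open>v\<close>
  and \<open>w\<close> (\<open>spans_edge_by_potential\<close>). Thus arcs with a common tail or a common head are always joined, while for consecutive arcs and
  for disjoint arcs only triangles and 4-cycles matter.

  For the forward direction a single edge \<open>ij\<close> suffices. Let \<open>A\<close> and \<open>B\<close> be the sets of the other
  graph neighbours of \<open>i\<close> and of \<open>j\<close>, put \<open>U = {i, j} \<union> A \<union> B\<close>, let \<open>F\<close> be the set of edges that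
  leave \<open>U\<close>, and let \<open>S\<close> be the set of the remaining skeleton neighbours of \<open>(i, j)\<close>, those inside \<open>U\<close> that
  share neither its tail nor its head. Both orientations of an edge in \<open>F\<close> are neighbours of
  \<open>(i, j)\<close>, so the degree is at least \<open>|A| + |B| + |S| + 2|F|\<close>. The dimension is at most
  \<open>1 + |A \<union> B| + |F|\<close>. If the two numbers agree then \<open>|A \<inter> B| + |S| + |F| \<le> 1\<close>. Moreover, every
  node of \<open>A - B\<close> is the tail, and every node of \<open>B - A\<close> the head, of an arc in \<open>S\<close>. Hence
  \<open>|F| = 1\<close> leaves two disjoint edges, \<open>|A \<inter> B| = 1\<close> a triangle, and otherwise \<open>A\<close> and \<open>B\<close> have
  at most one element each, which gives a path with one or two edges, or a 4-cycle
  (\<open>edges_if_degree_eq_dim\<close>).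

  Conversely each of the five graphs is small enough to list the neighbours of an arc; its
  symmetries leave one arc to look at, or two for the path with two edges.
\<close>

section \<open>Arcs and their vectors\<close>

lemma edge_doubleton:
  assumes "finite_simple_graph G" "e \<in> edges G"
  obtains u v where "e = {u, v}" "u \<noteq> v"
  using assms by (metis finite_simple_graph_def card_2_iff)

definition arc_vec :: "'n \<times> 'n \<Rightarrow> real ^ 'n" where
  "arc_vec a = axis (fst a) 1 - axis (snd a) 1"

definition arcs :: "'n graph \<Rightarrow> ('n \<times> 'n) set" where
  "arcs G = {(i, j). {i, j} \<in> edges G}"

text \<open>Adjacency in the 1-skeleton, phrased through arcs; the dimension of the segment is 1
  because different arcs have different vectors.\<close>
definition spans_edge :: "'n::finite graph \<Rightarrow> 'n \<times> 'n \<Rightarrow> 'n \<times> 'n \<Rightarrow> bool" where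
  "spans_edge G a b \<longleftrightarrow> a \<in> arcs G \<and> b \<in> arcs G \<and> a \<noteq> b \<and>
     closed_segment (arc_vec a) (arc_vec b) face_of symmetric_edge_polytope G"

lemma symmetric_edge_polytope_arcs:
  "symmetric_edge_polytope G = convex hull (arc_vec ` arcs G)"
  unfolding symmetric_edge_polytope_def arcs_def arc_vec_def
  by (rule arg_cong[where f = "\<lambda>S. convex hull S"]) force

lemma arcs_swap: "(i, j) \<in> arcs G \<longleftrightarrow> (j, i) \<in> arcs G"
  by (simp add: arcs_def insert_commute)

lemma inner_arc_vec: "vec_lambda p \<bullet> arc_vec (i, j) = p i - p j"
  by (simp add: arc_vec_def inner_diff_right inner_axis)

lemma arc_vec_swap: "arc_vec (j, i) = - arc_vec (i, j)"
  by (simp add: arc_vec_def)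

lemma arc_vec_eq_iff:
  fixes i j k l :: "'n::finite"
  assumes "i \<noteq> j" "k \<noteq> l"
  shows "arc_vec (i, j) = arc_vec (k, l) \<longleftrightarrow> i = k \<and> j = l"
proof
  assume "arc_vec (i, j) = arc_vec (k, l)"
  then have "arc_vec (i, j) $ x = arc_vec (k, l) $ x" for x by simp
  from this[of i] this[of j] show "i = k \<and> j = l"
    using assms by (auto simp: arc_vec_def axis_def split: if_splits)
qed simp

lemma spans_edge_commute: "spans_edge G a b \<longleftrightarrow> spans_edge G b a"
  by (auto simp: spans_edge_def closed_segment_commute)

text \<open>Together with the single vector \<open>axis i 1\<close>, the star at \<open>i\<close> spans \<open>card X + 1\<close> unit
  vectors, and one vector raises the dimension by at most 1.\<close>
lemma dim_star_vectors:
  fixes i :: "'n::finite"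
  assumes "i \<notin> X"
  shows "dim ((\<lambda>x. arc_vec (i, x)) ` X) = card X"
proof (rule antisym)
  let ?S = "(\<lambda>x. arc_vec (i, x)) ` X"
  have fin: "finite X" by simp
  have "dim ?S \<le> card ?S" by (rule dim_le_card) (auto simp: span_superset)
  also have "\<dots> \<le> card X" by (rule card_image_le[OF fin])
  finally show "dim ?S \<le> card X" .
  have "axis x 1 \<in> span (insert (axis i 1) ?S)" if "x \<in> insert i X" for x
  proof (cases "x = i")
    case False
    have "axis x 1 = axis i 1 - arc_vec (i, x)" by (simp add: arc_vec_def)
    moreover have "axis i 1 - arc_vec (i, x) \<in> span (insert (axis i 1) ?S)"
      using that False by (intro span_diff span_base) auto
    ultimately show ?thesis by simp
  qed (simp add: span_base)
  then have sub: "(\<lambda>x. axis x (1::real)) ` insert i X \<subseteq> span (insert (axis i 1) ?S)" by auto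
  have "independent ((\<lambda>x. axis x (1::real)) ` insert i X)"
    by (rule independent_mono[OF independent_Basis]) (auto simp: Basis_vec_def)
  then have "card ((\<lambda>x. axis x (1::real)) ` insert i X) \<le> dim (insert (axis i 1) ?S)"
    using sub by (metis dim_span independent_card_le_dim)
  moreover have "inj (\<lambda>x::'n. axis x (1::real))"
    by (auto simp: inj_on_def axis_eq_axis)
  then have "card ((\<lambda>x. axis x (1::real)) ` insert i X) = card (insert i X)"
    by (meson card_image inj_on_subset subset_UNIV)
  ultimately have "Suc (card X) \<le> dim (insert (axis i 1) ?S)"
    using assms fin by simp
  also have "\<dots> \<le> Suc (dim ?S)" by (simp add: dim_insert)
  finally show "card X \<le> dim ?S" by simp
qed

locale simple_graph =
  fixes G :: "'n::finite graph"
  assumes simple: "finite_simple_graph G"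
begin

abbreviation P where "P \<equiv> symmetric_edge_polytope G"

lemma arc_neq: "(i, j) \<in> arcs G \<Longrightarrow> i \<noteq> j"
  using simple by (force simp: arcs_def finite_simple_graph_def)

lemma inj_on_arc_vec: "inj_on arc_vec (arcs G)"
proof (rule inj_onI)
  fix a b assume *: "a \<in> arcs G" "b \<in> arcs G" "arc_vec a = arc_vec b"
  obtain i j k l where ab: "a = (i, j)" "b = (k, l)" by fastforce
  then have "i \<noteq> j" "k \<noteq> l" using * arc_neq by blast+
  then show "a = b" using * ab arc_vec_eq_iff[of i j k l] by simp
qed

lemma finite_arcs [simp]: "finite (arcs G)"
  by (rule finite_subset[OF subset_UNIV]) simp

lemma polytope_P: "polytope P"
  by (simp add: symmetric_edge_polytope_arcs polytope_convex_hull)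

lemma arc_vec_in_P: "a \<in> arcs G \<Longrightarrow> arc_vec a \<in> P"
  by (simp add: symmetric_edge_polytope_arcs hull_inc)

lemma zero_in_P:
  assumes "arcs G \<noteq> {}"
  shows "0 \<in> P"
proof -
  obtain i j where ij: "(i, j) \<in> arcs G" using assms by auto
  then have "arc_vec (i, j) \<in> P" "- arc_vec (i, j) \<in> P"
    by (metis arc_vec_in_P, metis arc_vec_in_P arc_vec_swap arcs_swap)
  moreover have "convex P" by (simp add: symmetric_edge_polytope_arcs)
  ultimately have "(1/2) *\<^sub>R arc_vec (i, j) + (1/2) *\<^sub>R (- arc_vec (i, j)) \<in> P"
    by (intro convexD) auto
  then show ?thesis by simp
qed

lemma aff_dim_P:
  assumes "arcs G \<noteq> {}"
  shows "aff_dim P = int (dim (arc_vec ` arcs G))"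
proof -
  have "0 \<in> affine hull (arc_vec ` arcs G)"
    using zero_in_P[OF assms] convex_hull_subset_affine_hull
    by (auto simp: symmetric_edge_polytope_arcs)
  then show ?thesis
    by (metis aff_dim_convex_hull aff_dim_zero symmetric_edge_polytope_arcs)
qed

text \<open>A potential \<open>p\<close> on the nodes is a linear functional whose value on \<open>e\<^sub>x - e\<^sub>y\<close> is the drop
  \<open>p x - p y\<close>. The arcs of maximal drop form a face, and every face used below is exhibited in
  this way.\<close>
lemma face_by_potential:
  fixes p :: "'n \<Rightarrow> real"
  assumes "T \<subseteq> arcs G"
    and eq: "\<And>x y. (x, y) \<in> T \<Longrightarrow> p x - p y = c"
    and less: "\<And>x y. (x, y) \<in> arcs G \<Longrightarrow> (x, y) \<notin> T \<Longrightarrow> p x - p y < c"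
  shows "convex hull (arc_vec ` T) face_of P"
proof -
  let ?q = "vec_lambda p"
  have "affine hull (arc_vec ` T) \<subseteq> {v. ?q \<bullet> v = c}"
    by (rule hull_minimal) (auto simp: inner_arc_vec eq affine_hyperplane)
  moreover have "convex hull (arc_vec ` arcs G - arc_vec ` T) \<subseteq> {v. ?q \<bullet> v < c}"
  proof (rule hull_minimal)
    show "arc_vec ` arcs G - arc_vec ` T \<subseteq> {v. ?q \<bullet> v < c}"
    proof
      fix v assume "v \<in> arc_vec ` arcs G - arc_vec ` T"
      then obtain x y where "v = arc_vec (x, y)" "(x, y) \<in> arcs G" "(x, y) \<notin> T" by auto
      then show "v \<in> {v. ?q \<bullet> v < c}" by (simp add: less inner_arc_vec)
    qed
  qed (rule convex_halfspace_lt)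
  ultimately show ?thesis
    unfolding symmetric_edge_polytope_arcs
    using assms(1) by (intro face_of_convex_hulls finite_imageI finite_arcs image_mono) force+
qed

lemma spans_edge_by_potential:
  fixes p :: "'n \<Rightarrow> real"
  assumes "a \<in> arcs G" "b \<in> arcs G" "a \<noteq> b"
    and "p (fst a) - p (snd a) = c" "p (fst b) - p (snd b) = c"
    and "\<And>x y. (x, y) \<in> arcs G \<Longrightarrow> (x, y) \<noteq> a \<Longrightarrow> (x, y) \<noteq> b \<Longrightarrow> p x - p y < c"
  shows "spans_edge G a b"
proof -
  have "convex hull (arc_vec ` {a, b}) face_of P"
    by (rule face_by_potential[of _ p c]) (use assms in auto)
  then show ?thesis using assms by (simp add: spans_edge_def segment_convex_hull)
qed

lemma extreme_arc_vec:
  assumes "a \<in> arcs G"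
  shows "arc_vec a extreme_point_of P"
proof -
  obtain i j where a: "a = (i, j)" by fastforce
  have "convex hull (arc_vec ` {a}) face_of P"
    by (rule face_by_potential[of _ "\<lambda>x. if x = i then 1 else if x = j then 0 else 1/2" 1])
      (use assms a arc_neq[of i j] in auto)
  then show ?thesis by (simp add: face_of_singleton)
qed

lemma extreme_point_of_P_iff: "v extreme_point_of P \<longleftrightarrow> v \<in> arc_vec ` arcs G"
  using extreme_arc_vec extreme_point_of_convex_hull
  by (auto simp: symmetric_edge_polytope_arcs)

text \<open>A face is the hull of the arc vectors it contains. If it is one-dimensional then these are
  collinear, and three collinear points cannot all be extreme.\<close>
lemma edge_through_arc_vec:
  assumes "F edge_of P" "arc_vec a \<in> F" "a \<in> arcs G"
  shows "\<exists>b. spans_edge G a b \<and> F = closed_segment (arc_vec a) (arc_vec b)"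
proof -
  have F: "F face_of convex hull (arc_vec ` arcs G)" "aff_dim F = 1"
    using assms(1) by (auto simp: edge_of_def symmetric_edge_polytope_arcs)
  have "compact (arc_vec ` arcs G)" by (simp add: finite_imp_compact)
  then obtain T where T: "T \<subseteq> arc_vec ` arcs G" "F = convex hull T"
    using face_of_convex_hull_subset[OF _ F(1)] by blast
  have ext: "w extreme_point_of F" if "w \<in> F" "w \<in> arc_vec ` arcs G" for w
    using that extreme_point_of_face[OF F(1)] by (simp add: extreme_point_of_P_iff flip: symmetric_edge_polytope_arcs)
  have aT: "arc_vec a \<in> T"
    using ext assms(2,3) extreme_point_of_convex_hull T(2) by blast
  have "T \<noteq> {arc_vec a}" using F(2) T(2) by auto
  then obtain w where w: "w \<in> T" "w \<noteq> arc_vec a" using aT by blast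
  have "u \<in> {arc_vec a, w}" if u: "u \<in> T" for u
  proof (rule ccontr)
    assume u': "u \<notin> {arc_vec a, w}"
    have sub: "x \<in> T" if "x \<in> {arc_vec a, w, u}" for x
      using that aT w u by blast
    have *: "x extreme_point_of F" "x \<in> F" if "x \<in> {arc_vec a, w, u}" for x
      using sub[OF that] T ext hull_inc[of x T convex] by auto
    have "aff_dim {arc_vec a, w, u} \<le> 1"
      using aff_dim_subset[of "{arc_vec a, w, u}" F] F(2) *(2) by (metis subsetI)
    then have "collinear {arc_vec a, w, u}" by (simp add: collinear_aff_dim)
    then have "between (w, u) (arc_vec a) \<or> between (u, arc_vec a) w \<or> between (arc_vec a, w) u"
      by (simp add: collinear_between_cases)
    then have "arc_vec a \<in> open_segment w u \<or> w \<in> open_segment u (arc_vec a)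
        \<or> u \<in> open_segment (arc_vec a) w"
      using w u' by (auto simp: between_mem_segment open_segment_def)
    then show False
      using *[of "arc_vec a"] *[of w] *[of u] unfolding extreme_point_of_def by simp
  qed
  then have Teq: "T = {arc_vec a, w}" using aT w by blast
  obtain b where b: "b \<in> arcs G" "w = arc_vec b" using w T by blast
  have F_eq: "F = closed_segment (arc_vec a) (arc_vec b)"
    using T(2) Teq b by (simp add: segment_convex_hull)
  moreover have "a \<noteq> b" using b w by auto
  ultimately have "spans_edge G a b"
    using b(1) assms(1,3) by (simp add: spans_edge_def edge_of_def)
  then show ?thesis using F_eq by blast
qed

lemma card_edges_at_arc_vec:
  assumes "a \<in> arcs G"
  shows "card {F. F edge_of P \<and> arc_vec a \<in> F} = card {b. spans_edge G a b}"
proof -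
  let ?s = "\<lambda>b. closed_segment (arc_vec a) (arc_vec b)"
  have "inj_on ?s {b. spans_edge G a b}"
  proof (rule inj_onI)
    fix b c assume *: "b \<in> {b. spans_edge G a b}" "c \<in> {b. spans_edge G a b}" "?s b = ?s c"
    then have "arc_vec b = arc_vec c"
      by (metis (no_types, lifting) closed_segment_eq doubleton_eq_iff)
    then show "b = c" using * inj_on_arc_vec by (auto simp: spans_edge_def dest: inj_onD)
  qed
  moreover have "{F. F edge_of P \<and> arc_vec a \<in> F} = ?s ` {b. spans_edge G a b}"
  proof (intro equalityI subsetI)
    fix F assume "F \<in> {F. F edge_of P \<and> arc_vec a \<in> F}"
    then show "F \<in> ?s ` {b. spans_edge G a b}"
      using edge_through_arc_vec[of F a] assms by auto
  next
    fix F assume "F \<in> ?s ` {b. spans_edge G a b}"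
    then obtain b where b: "spans_edge G a b" "F = ?s b" by auto
    then have "arc_vec a \<noteq> arc_vec b"
      using inj_on_arc_vec by (auto simp: spans_edge_def dest: inj_onD)
    then have "aff_dim F = 1"
      by (simp add: b(2) segment_convex_hull aff_dim_convex_hull aff_dim_2)
    then show "F \<in> {F. F edge_of P \<and> arc_vec a \<in> F}"
      using b by (auto simp: edge_of_def spans_edge_def)
  qed
  ultimately show ?thesis by (simp add: card_image)
qed

lemma simple_polytope_iff:
  assumes "arcs G \<noteq> {}"
  shows "simple_polytope P \<longleftrightarrow>
    (\<forall>a \<in> arcs G. card {b. spans_edge G a b} = dim (arc_vec ` arcs G))"
  using polytope_P
  unfolding simple_polytope_def extreme_point_of_P_iff aff_dim_P[OF assms]
  by (simp add: card_edges_at_arc_vec Ball_image_comp flip: Ball_def)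

section \<open>Adjacency of vertices\<close>

text \<open>With a common tail (or head) the end nodes get potentials 1 and 0, and all other nodes get
  \<open>1/2\<close>, so that no further arc has drop 1.\<close>
lemma spans_edge_common_tail:
  assumes "(i, j) \<in> arcs G" "(i, l) \<in> arcs G" "j \<noteq> l"
  shows "spans_edge G (i, j) (i, l)"
  by (rule spans_edge_by_potential[of _ _ "\<lambda>x. if x = i then 1 else if x = j \<or> x = l then 0 else 1/2" 1])
    (use assms arc_neq[OF assms(1)] arc_neq[OF assms(2)] in auto)

lemma spans_edge_common_head:
  assumes "(i, j) \<in> arcs G" "(k, j) \<in> arcs G" "i \<noteq> k"
  shows "spans_edge G (i, j) (k, j)"
  by (rule spans_edge_by_potential[of _ _ "\<lambda>x. if x = j then 0 else if x = i \<or> x = k then 1 else 1/2" 1])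
    (use assms arc_neq[OF assms(1)] arc_neq[OF assms(2)] in auto)

text \<open>The midpoint of \<open>a\<close> and \<open>b\<close> is also the midpoint of \<open>c\<close> and \<open>a + b - c\<close>. A face through the
  former two would therefore contain \<open>c\<close>, but a segment has no third extreme point.\<close>
lemma not_spans_edge_if_exchange:
  assumes "a \<in> arcs G" "b \<in> arcs G" "c \<in> arcs G" "c \<noteq> a" "c \<noteq> b"
    and "arc_vec a + arc_vec b - arc_vec c \<in> P"
  shows "\<not> spans_edge G a b"
proof
  let ?d = "arc_vec a + arc_vec b - arc_vec c" and ?S = "closed_segment (arc_vec a) (arc_vec b)"
  assume "spans_edge G a b"
  then have face: "?S face_of P" by (simp add: spans_edge_def)
  have "midpoint (arc_vec c) ?d = midpoint (arc_vec a) (arc_vec b)"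
    by (simp add: midpoint_def)
  then have mid: "midpoint (arc_vec c) ?d \<in> ?S" by simp
  have cS: "arc_vec c \<in> ?S"
  proof (cases "arc_vec c = ?d")
    case True
    then show ?thesis using mid by (metis midpoint_idem)
  next
    case False
    then have "midpoint (arc_vec c) ?d \<in> open_segment (arc_vec c) ?d" by simp
    then show ?thesis using face_ofD[OF face _ _ _ mid] assms arc_vec_in_P by blast
  qed
  have "arc_vec c extreme_point_of ?S"
    using extreme_point_of_face[OF face] cS extreme_arc_vec assms by blast
  then have "arc_vec c = arc_vec a \<or> arc_vec c = arc_vec b"
    by (simp add: extreme_point_of_segment)
  then show False using assms inj_on_arc_vec by (auto dest: inj_onD)
qed

lemma not_spans_edge_if_exchange_arc:
  assumes "a \<in> arcs G" "b \<in> arcs G" "c \<in> arcs G" "c \<noteq> a" "c \<noteq> b"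
    and "d \<in> arcs G" "arc_vec a + arc_vec b = arc_vec c + arc_vec d"
  shows "\<not> spans_edge G a b"
  by (rule not_spans_edge_if_exchange[OF assms(1-5)]) (simp add: assms(6,7) arc_vec_in_P)

text \<open>Opposite vertices have midpoint 0, as has every other antipodal pair of vertices.\<close>
lemma spans_edge_opposite_iff:
  assumes "(i, j) \<in> arcs G"
  shows "spans_edge G (i, j) (j, i) \<longleftrightarrow> arcs G = {(i, j), (j, i)}"
proof
  assume *: "spans_edge G (i, j) (j, i)"
  have "(k, l) \<in> {(i, j), (j, i)}" if "(k, l) \<in> arcs G" for k l
  proof (rule ccontr)
    assume "(k, l) \<notin> {(i, j), (j, i)}"
    then have "\<not> spans_edge G (i, j) (j, i)"
      by (intro not_spans_edge_if_exchange_arc[of _ _ "(k, l)" "(l, k)"])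
        (use assms that arcs_swap[of i j] arcs_swap[of k l] in \<open>auto simp: arc_vec_def\<close>)
    with * show False by blast
  qed
  then show "arcs G = {(i, j), (j, i)}" using assms arcs_swap[of i j] by auto
next
  assume "arcs G = {(i, j), (j, i)}"
  then show "spans_edge G (i, j) (j, i)"
    by (intro spans_edge_by_potential[of _ _ "\<lambda>x. 0" 0]) (use arc_neq[OF assms] in auto)
qed

text \<open>Here \<open>e\<^sub>i - e\<^sub>l\<close> is the sum of the two vectors. An arc \<open>(i, l)\<close> closes a triangle and allows
  the exchange with \<open>(i, l)\<close> and the point 0; a second path \<open>i, m, l\<close> closes a 4-cycle and allows the
  exchange with its two arcs.\<close>
lemma spans_edge_consecutive_iff:
  assumes ij: "(i, j) \<in> arcs G" and jl: "(j, l) \<in> arcs G" and "i \<noteq> l"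
  shows "spans_edge G (i, j) (j, l) \<longleftrightarrow>
    (i, l) \<notin> arcs G \<and> (\<forall>m. (i, m) \<in> arcs G \<and> (m, l) \<in> arcs G \<longrightarrow> m = j)"
    (is "_ \<longleftrightarrow> ?R")
proof
  assume *: "spans_edge G (i, j) (j, l)"
  show ?R
  proof (intro conjI allI impI notI)
    assume "(i, l) \<in> arcs G"
    moreover have "arc_vec (i, j) + arc_vec (j, l) - arc_vec (i, l) = 0"
      by (simp add: arc_vec_def)
    ultimately have "\<not> spans_edge G (i, j) (j, l)"
      by (intro not_spans_edge_if_exchange[of _ _ "(i, l)"])
        (use zero_in_P ij jl arc_neq[OF ij] arc_neq[OF jl] in auto)
    with * show False by blast
  next
    fix m assume m: "(i, m) \<in> arcs G \<and> (m, l) \<in> arcs G"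
    show "m = j"
    proof (rule ccontr)
      assume "m \<noteq> j"
      then have "\<not> spans_edge G (i, j) (j, l)"
        by (intro not_spans_edge_if_exchange_arc[of _ _ "(i, m)" "(m, l)"])
          (use m ij jl \<open>m \<noteq> j\<close> arc_neq[OF ij] in \<open>auto simp: arc_vec_def\<close>)
      with * show False by blast
    qed
  qed
next
  assume R: ?R
  \<comment> \<open>The potential falls by 1 on both given arcs. The other nodes stay within \<open>1/3\<close> of \<open>j\<close>, on
    the side of the end they are joined to. As \<open>i\<close> and \<open>l\<close> are not joined and have no common
    neighbour besides \<open>j\<close>, every other drop is at most \<open>2/3\<close>.\<close>
  let ?p = "\<lambda>x::'n. if x = i then 1 else if x = j then 0 else if x = l then -1
    else if (i, x) \<in> arcs G then 1/3 else if (x, l) \<in> arcs G then -1/3 else 0 :: real"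
  show "spans_edge G (i, j) (j, l)"
  proof (rule spans_edge_by_potential[of _ _ ?p 1])
    fix x y assume xy: "(x, y) \<in> arcs G" "(x, y) \<noteq> (i, j)" "(x, y) \<noteq> (j, l)"
    have "x \<noteq> y" using xy arc_neq by blast
    then show "?p x - ?p y < 1"
      using xy R arcs_swap[of x y] \<open>i \<noteq> l\<close> arc_neq[OF ij] arc_neq[OF jl] by auto
  qed (use assms arc_neq[OF ij] arc_neq[OF jl] in auto)
qed

text \<open>With potentials \<open>1, 0\<close> on \<open>i, j\<close> and \<open>2/3, -1/3\<close> on \<open>k, l\<close>, the only other drop of size at
  least 1 would be the one along \<open>(i, l)\<close>.\<close>
lemma spans_edge_disjoint_aux:
  assumes "(i, j) \<in> arcs G" "(k, l) \<in> arcs G" "{i, j} \<inter> {k, l} = {}" "(i, l) \<notin> arcs G"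
  shows "spans_edge G (i, j) (k, l)"
proof -
  let ?p = "\<lambda>x::'n. if x = i then 1 else if x = j then 0 else if x = k then 2/3
    else if x = l then -1/3 else 1/3 :: real"
  show ?thesis
  proof (rule spans_edge_by_potential[of _ _ ?p 1])
    fix x y assume xy: "(x, y) \<in> arcs G" "(x, y) \<noteq> (i, j)" "(x, y) \<noteq> (k, l)"
    then show "?p x - ?p y < 1" using assms(3,4) by auto
  qed (use assms arc_neq[OF assms(1)] arc_neq[OF assms(2)] in auto)
qed

text \<open>Two disjoint arcs can exchange their heads exactly when \<open>(i, l)\<close> and \<open>(k, j)\<close> are arcs as
  well, which is a 4-cycle through them.\<close>
lemma spans_edge_disjoint_iff:
  assumes "(i, j) \<in> arcs G" "(k, l) \<in> arcs G" "{i, j} \<inter> {k, l} = {}"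
  shows "spans_edge G (i, j) (k, l) \<longleftrightarrow> \<not> ((i, l) \<in> arcs G \<and> (k, j) \<in> arcs G)"
proof
  assume *: "spans_edge G (i, j) (k, l)"
  show "\<not> ((i, l) \<in> arcs G \<and> (k, j) \<in> arcs G)"
  proof
    assume "(i, l) \<in> arcs G \<and> (k, j) \<in> arcs G"
    then have "\<not> spans_edge G (i, j) (k, l)"
      by (intro not_spans_edge_if_exchange_arc[of _ _ "(i, l)" "(k, j)"])
        (use assms in \<open>auto simp: arc_vec_def\<close>)
    with * show False by blast
  qed
next
  assume "\<not> ((i, l) \<in> arcs G \<and> (k, j) \<in> arcs G)"
  then consider "(i, l) \<notin> arcs G" | "(k, j) \<notin> arcs G" by blast
  then show "spans_edge G (i, j) (k, l)"
  proof cases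
    case 1
    then show ?thesis using spans_edge_disjoint_aux assms by blast
  next
    case 2
    then have "spans_edge G (k, l) (i, j)" using spans_edge_disjoint_aux assms by blast
    then show ?thesis by (simp add: spans_edge_commute)
  qed
qed

section \<open>Dimension\<close>

text \<open>Inside \<open>insert i X\<close> every arc vector is a difference of two vectors of the star at \<open>i\<close>; each
  of the remaining edges contributes one line.\<close>
lemma dim_arc_vec_le:
  "dim (arc_vec ` arcs G) \<le> card X + card {e \<in> edges G. \<not> e \<subseteq> insert i X}"
proof -
  let ?F = "{e \<in> edges G. \<not> e \<subseteq> insert i X}"
  \<comment> \<open>an arbitrary orientation of each edge\<close>
  define r where "r e = (SOME a. {fst a, snd a} = e)" for e :: "'n set"
  let ?B = "(\<lambda>x. arc_vec (i, x)) ` X \<union> (arc_vec \<circ> r) ` ?F"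
  have "arc_vec ` arcs G \<subseteq> span ?B"
  proof
    fix v assume "v \<in> arc_vec ` arcs G"
    then obtain k l where kl: "(k, l) \<in> arcs G" and v: "v = arc_vec (k, l)" by auto
    show "v \<in> span ?B"
    proof (cases "{k, l} \<subseteq> insert i X")
      case True
      have star: "arc_vec (i, x) \<in> span ?B" if "x \<in> insert i X" for x
      proof (cases "x = i")
        case True
        then show ?thesis by (simp add: arc_vec_def span_zero)
      next
        case False
        then show ?thesis using that by (intro span_base) auto
      qed
      have "v = arc_vec (i, l) - arc_vec (i, k)" by (simp add: v arc_vec_def)
      then show ?thesis using True star by (simp add: span_diff)
    next
      case False
      then have "{k, l} \<in> ?F" using kl by (simp add: arcs_def)
      then have base: "arc_vec (r {k, l}) \<in> span ?B" by (intro span_base) (simp add: image_iff, blast)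
      have "{fst (r {k, l}), snd (r {k, l})} = {k, l}"
        unfolding r_def by (rule someI[of _ "(k, l)"]) simp
      then have "r {k, l} = (k, l) \<or> r {k, l} = (l, k)"
        by (auto simp: doubleton_eq_iff prod_eq_iff)
      then show ?thesis
        using base v span_neg[OF base] by (auto simp: arc_vec_swap[of k l])
    qed
  qed
  moreover have "finite ?B" by simp
  ultimately have "dim (arc_vec ` arcs G) \<le> card ?B" by (rule dim_le_card)
  also have "\<dots> \<le> card X + card ?F"
    by (rule order_trans[OF card_Un_le add_mono[OF card_image_le card_image_le]]) auto
  finally show ?thesis .
qed

text \<open>The star at \<open>i\<close> then spans the same space as all arcs.\<close>
lemma dim_arc_vec_connected:
  assumes "i \<notin> X" "\<And>x y. (x, y) \<in> arcs G \<Longrightarrow> x \<in> insert i X"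
    and "\<And>x. x \<in> X \<Longrightarrow> arc_vec (i, x) \<in> span (arc_vec ` arcs G)"
  shows "dim (arc_vec ` arcs G) = card X"
proof (rule antisym)
  have "{e \<in> edges G. \<not> e \<subseteq> insert i X} = {}"
  proof (rule ccontr)
    assume "{e \<in> edges G. \<not> e \<subseteq> insert i X} \<noteq> {}"
    then obtain e where e: "e \<in> edges G" "\<not> e \<subseteq> insert i X" by blast
    then obtain x y where "e = {x, y}"
      by (metis edge_doubleton[OF simple])
    then show False using e assms(2)[of x y] assms(2)[of y x] by (auto simp: arcs_def insert_commute)
  qed
  then show "dim (arc_vec ` arcs G) \<le> card X" using dim_arc_vec_le[of X i] by (simp only: card.empty add_0_right)
  have "card X = dim ((\<lambda>x. arc_vec (i, x)) ` X)" using dim_star_vectors[OF assms(1)] by simp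
  also have "\<dots> \<le> dim (span (arc_vec ` arcs G))" by (rule dim_subset) (use assms(3) in auto)
  finally show "card X \<le> dim (arc_vec ` arcs G)" by (simp add: dim_span)
qed

lemma arc_vec_in_span_arcs:
  assumes "(x, y) \<in> arcs G"
  shows "arc_vec (x, y) \<in> span (arc_vec ` arcs G)"
  using assms by (simp add: span_base)

lemma arc_vec_in_span_trans:
  assumes "(x, y) \<in> arcs G" "(y, z) \<in> arcs G"
  shows "arc_vec (x, z) \<in> span (arc_vec ` arcs G)"
proof -
  have "arc_vec (x, z) = arc_vec (x, y) + arc_vec (y, z)" by (simp add: arc_vec_def)
  then show ?thesis using assms by (simp add: span_add arc_vec_in_span_arcs)
qed

section \<open>A vertex of minimal degree determines the graph\<close>

lemma edges_eqI:
  assumes "\<And>x y. (x, y) \<in> arcs G \<Longrightarrow> {x, y} \<in> X" "X \<subseteq> edges G"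
  shows "edges G = X"
proof (intro equalityI subsetI assms(2)[THEN subsetD])
  fix e assume e: "e \<in> edges G"
  then obtain x y where "e = {x, y}"
    by (metis edge_doubleton[OF simple])
  then show "e \<in> X" using assms(1)[of x y] e by (simp add: arcs_def)
qed

lemma card_arcs_over_edges:
  assumes "F \<subseteq> edges G"
  shows "card {(x, y). {x, y} \<in> F} = 2 * card F"
proof -
  have fin: "finite F" by (rule finite_subset[OF subset_UNIV]) simp
  have "{(x, y). {x, y} \<in> F} = (\<Union>e \<in> F. {(x, y). {x, y} = e})" by auto
  also have "card \<dots> = (\<Sum>e \<in> F. card {(x, y). {x, y} = e})"
    by (rule card_UN_disjoint) (use fin in \<open>auto intro: finite_subset[OF subset_UNIV]\<close>)
  also have "\<dots> = (\<Sum>e \<in> F. 2)"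
  proof (rule sum.cong)
    fix e assume "e \<in> F"
    then obtain u v where "e = {u, v}" "u \<noteq> v"
      using assms by (metis subsetD edge_doubleton[OF simple])
    then have "{(x, y). {x, y} = e} = {(u, v), (v, u)}" by (auto simp: doubleton_eq_iff)
    then show "card {(x, y). {x, y} = e} = 2" using \<open>u \<noteq> v\<close> by simp
  qed simp
  finally show ?thesis by simp
qed

text \<open>A graph neighbour \<open>a\<close> of \<open>i\<close> that is not joined to \<open>j\<close> is always the tail of one more
  neighbour of \<open>(i, j)\<close> in the 1-skeleton. If some graph neighbour \<open>b\<close> of \<open>j\<close> is joined to \<open>a\<close>,
  that neighbour is \<open>(a, b)\<close>: heads cannot be exchanged, since \<open>(a, j)\<close> is no arc. If there is no
  such \<open>b\<close>, then \<open>i\<close> is the only node between \<open>a\<close> and \<open>j\<close>, and \<open>(a, i)\<close> is the neighbour.\<close>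
lemma tail_neighbour_witness:
  assumes ij: "(i, j) \<in> arcs G" and ia: "(i, a) \<in> arcs G" "a \<noteq> j" and aj: "(a, j) \<notin> arcs G"
  shows "\<exists>y. spans_edge G (i, j) (a, y) \<and> a \<noteq> i \<and> y \<noteq> j \<and> (y = i \<or> (y, j) \<in> arcs G)"
proof (cases "\<exists>b. b \<noteq> i \<and> (b, j) \<in> arcs G \<and> (a, b) \<in> arcs G")
  case True
  then obtain b where b: "b \<noteq> i" "(b, j) \<in> arcs G" "(a, b) \<in> arcs G" by blast
  have "spans_edge G (i, j) (a, b)"
    by (subst spans_edge_disjoint_iff) (use b ij ia aj arc_neq[OF ia(1)] arc_neq[OF b(2)] in auto)
  then show ?thesis using b arc_neq[OF b(2)] arc_neq[OF ia(1)] by blast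
next
  case False
  have ai: "(a, i) \<in> arcs G" using ia(1) by (simp add: arcs_swap[of a i])
  have "spans_edge G (a, i) (i, j)"
    by (subst spans_edge_consecutive_iff) (use False ia aj ij ai in auto)
  then show ?thesis
    using arc_neq[OF ai] arc_neq[OF ij] by (auto simp: spans_edge_commute[of _ "(i, j)"])
qed

text \<open>The mirror image of the previous lemma under reversal of all arcs.\<close>
lemma head_neighbour_witness:
  assumes ij: "(i, j) \<in> arcs G" and bj: "(b, j) \<in> arcs G" "b \<noteq> i" and ib: "(i, b) \<notin> arcs G"
  shows "\<exists>x. spans_edge G (i, j) (x, b) \<and> b \<noteq> j \<and> x \<noteq> i \<and> (x = j \<or> (i, x) \<in> arcs G)"
proof (cases "\<exists>a. a \<noteq> j \<and> (i, a) \<in> arcs G \<and> (a, b) \<in> arcs G")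
  case True
  then obtain a where a: "a \<noteq> j" "(i, a) \<in> arcs G" "(a, b) \<in> arcs G" by blast
  have "spans_edge G (i, j) (a, b)"
    by (subst spans_edge_disjoint_iff) (use a ij bj ib arc_neq[OF bj(1)] arc_neq[OF a(2)] in auto)
  then show ?thesis using a arc_neq[OF a(2)] arc_neq[OF bj(1)] by blast
next
  case False
  have jb: "(j, b) \<in> arcs G" using bj(1) by (simp add: arcs_swap[of b j])
  have "spans_edge G (i, j) (j, b)"
    by (subst spans_edge_consecutive_iff) (use False bj ib ij jb in auto)
  then show ?thesis using arc_neq[OF jb] arc_neq[OF ij] by blast
qed

text \<open>The degree condition at one vertex already forces the graph: the degree counts \<open>A\<close> and \<open>B\<close>
  separately and every far edge twice, while the dimension counts \<open>A \<union> B\<close> and every far edge once.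
  The path with two edges occurs twice because \<open>i\<close> or \<open>j\<close> may be its middle node.\<close>
lemma edges_if_degree_eq_dim:
  assumes ij: "(i, j) \<in> arcs G"
    and deg: "card {b. spans_edge G (i, j) b} = dim (arc_vec ` arcs G)"
  obtains (P1) "edges G = {{i, j}}"
  | (two_P1) k l where "distinct [i, j, k, l]" "edges G = {{i, j}, {k, l}}"
  | (P2_tail) k where "distinct [i, j, k]" "edges G = {{j, i}, {i, k}}"
  | (P2_head) k where "distinct [i, j, k]" "edges G = {{i, j}, {j, k}}"
  | (C3) k where "distinct [i, j, k]" "edges G = {{i, j}, {j, k}, {k, i}}"
  | (C4) k l where "distinct [i, j, l, k]" "edges G = {{i, j}, {j, l}, {l, k}, {k, i}}"
proof -
  define A where "A = {x. x \<noteq> j \<and> (i, x) \<in> arcs G}"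
  define B where "B = {x. x \<noteq> i \<and> (x, j) \<in> arcs G}"
  define U where "U = insert i (insert j (A \<union> B))"
  define F where "F = {e \<in> edges G. \<not> e \<subseteq> U}"
  define S where "S = {(k, l). spans_edge G (i, j) (k, l) \<and> k \<noteq> i \<and> l \<noteq> j \<and> {k, l} \<subseteq> U}"
  have finS: "finite S" "finite F" by (rule finite_subset[OF subset_UNIV]; simp)+
  have "i \<noteq> j" using ij arc_neq by blast
  have A: "i \<notin> A" "j \<notin> A" and B: "i \<notin> B" "j \<notin> B"
    using arc_neq by (auto simp: A_def B_def)
  have far: "{i, j} \<inter> {k, l} = {}" "spans_edge G (i, j) (k, l)"
    if "(k, l) \<in> arcs G" "\<not> {k, l} \<subseteq> U" for k l
  proof -
    show *: "{i, j} \<inter> {k, l} = {}"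
      using that arcs_swap[of k l] by (auto simp: U_def A_def B_def)
    show "spans_edge G (i, j) (k, l)"
      using that * ij by (subst spans_edge_disjoint_iff) (auto simp: U_def A_def B_def)
  qed
  have key: "card (A \<inter> B) + card S + card F \<le> 1"
  proof -
    let ?TA = "Pair i ` A" and ?TB = "(\<lambda>x. (x, j)) ` B" and ?FA = "{(x, y). {x, y} \<in> F}"
    have sub: "?TA \<union> ?TB \<union> S \<union> ?FA \<subseteq> {b. spans_edge G (i, j) b}"
      using spans_edge_common_tail[OF ij] spans_edge_common_head[OF ij] far
      by (auto simp: A_def B_def S_def F_def arcs_def)
    have "?TA \<inter> ?TB = {}" "(?TA \<union> ?TB) \<inter> S = {}" "(?TA \<union> ?TB \<union> S) \<inter> ?FA = {}"
      using A B by (auto simp: S_def F_def U_def)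
    then have "card (?TA \<union> ?TB \<union> S \<union> ?FA) = card ?TA + card ?TB + card S + card ?FA"
      by (simp add: card_Un_disjoint finS)
    moreover have "card ?TA = card A" "card ?TB = card B"
      by (auto intro!: card_image inj_onI)
    moreover have "card ?FA = 2 * card F" by (rule card_arcs_over_edges) (simp add: F_def)
    moreover have "card (?TA \<union> ?TB \<union> S \<union> ?FA) \<le> card {b. spans_edge G (i, j) b}"
      by (rule card_mono[OF _ sub]) simp
    moreover have "dim (arc_vec ` arcs G) \<le> card (insert j (A \<union> B)) + card F"
      unfolding F_def U_def by (rule dim_arc_vec_le)
    moreover have "card (insert j (A \<union> B)) = Suc (card (A \<union> B))" using A B by simp
    moreover have "card A + card B = card (A \<union> B) + card (A \<inter> B)" by (rule card_Un_Int) simp_all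
    ultimately show ?thesis using deg by linarith
  qed
  have wA: "\<exists>y. (a, y) \<in> S" if "a \<in> A" "a \<notin> B" for a
  proof -
    have "(i, a) \<in> arcs G" "a \<noteq> j" "(a, j) \<notin> arcs G"
      using that A by (auto simp: A_def B_def)
    from tail_neighbour_witness[OF ij this] show ?thesis
      using that by (auto simp: S_def U_def B_def)
  qed
  have wB: "\<exists>x. (x, b) \<in> S" if "b \<in> B" "b \<notin> A" for b
  proof -
    have "(b, j) \<in> arcs G" "b \<noteq> i" "(i, b) \<notin> arcs G"
      using that B by (auto simp: A_def B_def)
    from head_neighbour_witness[OF ij this] show ?thesis
      using that by (auto simp: S_def U_def A_def)
  qed
  have E: "(x, y) \<in> arcs G \<Longrightarrow> {x, y} \<subseteq> U \<or> {x, y} \<in> F" for x y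
    by (auto simp: F_def arcs_def)
  have ijE: "{i, j} \<in> edges G" using ij by (simp add: arcs_def)
  consider "F \<noteq> {}" "card F = 1" "S = {}" "A \<inter> B = {}"
    | c where "F = {}" "S = {}" "A \<inter> B = {c}"
    | "F = {}" "S = {}" "A \<inter> B = {}"
    | s where "F = {}" "S = {s}" "A \<inter> B = {}"
  proof -
    have "card (A \<inter> B) = 0 \<or> card (A \<inter> B) = 1" "card S = 0 \<or> card S = 1" "card F = 0 \<or> card F = 1"
      using key by linarith+
    then show thesis
      using key that finS by (auto simp: card_1_singleton_iff)
  qed
  then show thesis
  proof cases
    case 1
    have "A = {}" "B = {}" using wA wB 1 by blast+
    then have U: "U = {i, j}" by (simp add: U_def)
    obtain f where f: "F = {f}" using 1 by (metis card_1_singletonE)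
    then have "f \<in> F" by simp
    then have fE: "f \<in> edges G" "\<not> f \<subseteq> U" by (simp_all add: F_def)
    then obtain k l where kl: "f = {k, l}" "k \<noteq> l"
      by (metis edge_doubleton[OF simple])
    then have "(k, l) \<in> arcs G" "\<not> {k, l} \<subseteq> U" using fE by (simp_all add: arcs_def)
    then have d: "distinct [i, j, k, l]" using far(1)[of k l] kl \<open>i \<noteq> j\<close> by auto
    have "edges G = {{i, j}, {k, l}}"
    proof (rule edges_eqI)
      fix x y assume xy: "(x, y) \<in> arcs G"
      then show "{x, y} \<in> {{i, j}, {k, l}}"
        using E[OF xy] arc_neq[OF xy] f kl U by auto
    qed (use ijE fE(1) kl in auto)
    then show thesis by (rule two_P1[OF d])
  next
    case 2
    have AB: "A = {c}" "B = {c}" using wA wB 2 by blast+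
    then have U: "U = {i, j, c}" by (simp add: U_def)
    have c: "(i, c) \<in> arcs G" "(c, j) \<in> arcs G" using AB by (auto simp: A_def B_def)
    have d: "distinct [i, j, c]" using A B AB \<open>i \<noteq> j\<close> by auto
    have "edges G = {{i, j}, {j, c}, {c, i}}"
    proof (rule edges_eqI)
      fix x y assume xy: "(x, y) \<in> arcs G"
      then show "{x, y} \<in> {{i, j}, {j, c}, {c, i}}"
        using E[OF xy] arc_neq[OF xy] 2 U by auto
    qed (use ijE c in \<open>auto simp: arcs_def insert_commute\<close>)
    then show thesis by (rule C3[OF d])
  next
    case 3
    have "A = {}" "B = {}" using wA wB 3 by blast+
    then have U: "U = {i, j}" by (simp add: U_def)
    have "edges G = {{i, j}}"
    proof (rule edges_eqI)
      fix x y assume xy: "(x, y) \<in> arcs G"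
      then show "{x, y} \<in> {{i, j}}"
        using E[OF xy] arc_neq[OF xy] 3 U by auto
    qed (use ijE in auto)
    then show thesis by (rule P1)
  next
    case 4
    obtain k l where s: "s = (k, l)" by fastforce
    have sub: "A \<subseteq> {k}" "B \<subseteq> {l}" using wA wB 4 s by blast+
    have kl: "(k, l) \<in> arcs G" using 4 s by (auto simp: S_def spans_edge_def)
    have mem: "x \<in> A \<longleftrightarrow> (i, x) \<in> arcs G" "x \<in> B \<longleftrightarrow> (x, j) \<in> arcs G"
      if "x \<noteq> i" "x \<noteq> j" for x using that by (auto simp: A_def B_def)
    have nb: "(x, y) \<in> arcs G \<Longrightarrow> x \<noteq> y \<and> x \<in> U \<and> y \<in> U \<and> (y, x) \<in> arcs G" for x y
      using E[of x y] 4 arc_neq arcs_swap[of x y] by auto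
    consider "A = {}" "B = {}" | "A = {k}" "B = {}" | "A = {}" "B = {l}" | "A = {k}" "B = {l}"
      using sub by blast
    then show thesis
    proof cases
      case 1
      then have "edges G = {{i, j}}"
        by (intro edges_eqI) (use nb ijE in \<open>auto simp: U_def\<close>)
      then show thesis by (rule P1)
    next
      case 2
      have d: "distinct [i, j, k]" using A 2 \<open>i \<noteq> j\<close> by auto
      have "edges G = {{j, i}, {i, k}}"
      proof (rule edges_eqI)
        fix x y assume xy: "(x, y) \<in> arcs G"
        then show "{x, y} \<in> {{j, i}, {i, k}}"
          using nb[OF xy] mem[of k] d 2 by (auto simp: U_def)
      qed (use ijE mem[of k] d 2 in \<open>auto simp: arcs_def insert_commute\<close>)
      then show thesis by (rule P2_tail[OF d])
    next
      case 3
      have d: "distinct [i, j, l]" using B 3 \<open>i \<noteq> j\<close> by auto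
      have "edges G = {{i, j}, {j, l}}"
      proof (rule edges_eqI)
        fix x y assume xy: "(x, y) \<in> arcs G"
        then show "{x, y} \<in> {{i, j}, {j, l}}"
          using nb[OF xy] mem[of l] d 3 by (auto simp: U_def)
      qed (use ijE mem[of l] d 3 in \<open>auto simp: arcs_def insert_commute\<close>)
      then show thesis by (rule P2_head[OF d])
    next
      case 4
      have d: "distinct [i, j, l, k]" using A B 4 \<open>i \<noteq> j\<close> arc_neq[OF kl] by auto
      have "edges G = {{i, j}, {j, l}, {l, k}, {k, i}}"
      proof (rule edges_eqI)
        fix x y assume xy: "(x, y) \<in> arcs G"
        then show "{x, y} \<in> {{i, j}, {j, l}, {l, k}, {k, i}}"
          using nb[OF xy] mem[of k] mem[of l] d 4 by (auto simp: U_def)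
      qed (use ijE mem[of k] mem[of l] kl d 4 in \<open>auto simp: arcs_def insert_commute\<close>)
      then show thesis by (rule C4[OF d])
    qed
  qed
qed

section \<open>The vertex degrees for the five graphs\<close>

lemma degree_eqI:
  assumes "\<And>b. b \<in> arcs G \<Longrightarrow> spans_edge G a b \<longleftrightarrow> b \<in> N" "N \<subseteq> arcs G"
  shows "card {b. spans_edge G a b} = card N"
proof -
  have "{b. spans_edge G a b} = N" using assms by (auto simp: spans_edge_def)
  then show ?thesis by simp
qed

lemma not_spans_edge_self [simp]: "\<not> spans_edge G a a"
  by (simp add: spans_edge_def)

lemma not_spans_edge_opposite:
  assumes "(i, j) \<in> arcs G" "(k, l) \<in> arcs G" "(k, l) \<noteq> (i, j)" "(k, l) \<noteq> (j, i)"
  shows "\<not> spans_edge G (i, j) (j, i)"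
proof
  assume "spans_edge G (i, j) (j, i)"
  then have "arcs G = {(i, j), (j, i)}" by (simp only: spans_edge_opposite_iff[OF assms(1)])
  with assms(2-4) show False by auto
qed

text \<open>The polytope of a single edge is a segment, the only case where opposite vertices are
  joined.\<close>
lemma degree_eq_dim_path_1:
  assumes "edges G = {{i, j}}" "i \<noteq> j"
  shows "card {b. spans_edge G (i, j) b} = dim (arc_vec ` arcs G)"
proof -
  have arcs: "arcs G = {(i, j), (j, i)}" using assms by (auto simp: arcs_def doubleton_eq_iff)
  have "card {b. spans_edge G (i, j) b} = card {(j, i)}"
  proof (rule degree_eqI)
    fix b assume "b \<in> arcs G"
    then show "spans_edge G (i, j) b \<longleftrightarrow> b \<in> {(j, i)}"
      using assms(2) spans_edge_opposite_iff[of i j] by (auto simp: arcs)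
  qed (simp add: arcs)
  moreover have "dim (arc_vec ` arcs G) = card {j}"
    by (rule dim_arc_vec_connected[of i]) (use assms(2) arc_vec_in_span_arcs[of i j] in \<open>auto simp: arcs\<close>)
  ultimately show ?thesis by simp
qed

text \<open>A square with diagonals along the two orthogonal lines of the edges.\<close>
lemma degree_eq_dim_two_path_1:
  assumes "edges G = {{i, j}, {k, l}}" and d: "distinct [i, j, k, l]"
  shows "card {b. spans_edge G (i, j) b} = dim (arc_vec ` arcs G)"
proof -
  have arcs: "arcs G = {(i, j), (j, i), (k, l), (l, k)}"
    using assms(1) by (auto simp: arcs_def doubleton_eq_iff)
  have "card {b. spans_edge G (i, j) b} = card {(k, l), (l, k)}"
  proof (rule degree_eqI)
    fix b assume "b \<in> arcs G"
    then consider "b = (i, j)" | "b = (j, i)" | "b = (k, l)" | "b = (l, k)" by (auto simp: arcs)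
    then show "spans_edge G (i, j) b \<longleftrightarrow> b \<in> {(k, l), (l, k)}"
    proof cases
      case 1 then show ?thesis using d by simp
    next
      case 2 then show ?thesis using d not_spans_edge_opposite[of i j k l] by (auto simp: arcs)
    next
      case 3 then show ?thesis using d spans_edge_disjoint_iff[of i j k l] by (auto simp: arcs)
    next
      case 4 then show ?thesis using d spans_edge_disjoint_iff[of i j l k] by (auto simp: arcs)
    qed
  qed (simp add: arcs)
  moreover have "dim (arc_vec ` arcs G) = card {arc_vec (i, j), arc_vec (k, l)}"
  proof (rule dim_eq_card)
    have "arc_vec (i, j) \<bullet> arc_vec (k, l) = 0" "arc_vec (i, j) \<noteq> 0" "arc_vec (k, l) \<noteq> 0"
      using d by (auto simp: arc_vec_def inner_diff_left inner_diff_right inner_axis_axis axis_eq_axis)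
    then show "independent {arc_vec (i, j), arc_vec (k, l)}"
      by (intro pairwise_orthogonal_independent)
        (auto simp: pairwise_def orthogonal_def inner_commute)
    show "span {arc_vec (i, j), arc_vec (k, l)} = span (arc_vec ` arcs G)"
      by (rule span_eq[THEN iffD2])
        (auto simp: arcs arc_vec_swap[of j i] arc_vec_swap[of l k] span_base span_neg)
  qed
  moreover have "arc_vec (i, j) \<noteq> arc_vec (k, l)"
    using d by (simp add: arc_vec_eq_iff)
  ultimately show ?thesis using d by simp
qed

text \<open>A parallelogram; the arc under consideration may enter or leave the middle node of the path.\<close>
lemma degree_eq_dim_path_2_head:
  assumes "edges G = {{i, j}, {j, k}}" and d: "distinct [i, j, k]"
  shows "card {b. spans_edge G (i, j) b} = dim (arc_vec ` arcs G)"
proof -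
  have arcs: "arcs G = {(i, j), (j, i), (j, k), (k, j)}"
    using assms(1) by (auto simp: arcs_def doubleton_eq_iff)
  have "card {b. spans_edge G (i, j) b} = card {(j, k), (k, j)}"
  proof (rule degree_eqI)
    fix b assume "b \<in> arcs G"
    then consider "b = (i, j)" | "b = (j, i)" | "b = (j, k)" | "b = (k, j)" by (auto simp: arcs)
    then show "spans_edge G (i, j) b \<longleftrightarrow> b \<in> {(j, k), (k, j)}"
    proof cases
      case 1 then show ?thesis using d by simp
    next
      case 2 then show ?thesis using d not_spans_edge_opposite[of i j j k] by (auto simp: arcs)
    next
      case 3 then show ?thesis using d spans_edge_consecutive_iff[of i j k] by (auto simp: arcs)
    next
      case 4 then show ?thesis using d spans_edge_common_head[of i j k] by (auto simp: arcs)
    qed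
  qed (simp add: arcs)
  moreover have "dim (arc_vec ` arcs G) = card {i, k}"
    by (rule dim_arc_vec_connected[of j])
      (use d arc_vec_in_span_arcs[of j i] arc_vec_in_span_arcs[of j k] in \<open>auto simp: arcs\<close>)
  ultimately show ?thesis using d by simp
qed

lemma degree_eq_dim_path_2_tail:
  assumes "edges G = {{j, i}, {i, k}}" and d: "distinct [i, j, k]"
  shows "card {b. spans_edge G (i, j) b} = dim (arc_vec ` arcs G)"
proof -
  have arcs: "arcs G = {(i, j), (j, i), (i, k), (k, i)}"
    using assms(1) by (auto simp: arcs_def doubleton_eq_iff)
  have "card {b. spans_edge G (i, j) b} = card {(i, k), (k, i)}"
  proof (rule degree_eqI)
    fix b assume "b \<in> arcs G"
    then consider "b = (i, j)" | "b = (j, i)" | "b = (i, k)" | "b = (k, i)" by (auto simp: arcs)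
    then show "spans_edge G (i, j) b \<longleftrightarrow> b \<in> {(i, k), (k, i)}"
    proof cases
      case 1 then show ?thesis using d by simp
    next
      case 2 then show ?thesis using d not_spans_edge_opposite[of i j i k] by (auto simp: arcs)
    next
      case 3 then show ?thesis using d spans_edge_common_tail[of i j k] by (auto simp: arcs)
    next
      case 4 then show ?thesis
        using d spans_edge_consecutive_iff[of k i j] by (subst spans_edge_commute) (auto simp: arcs)
    qed
  qed (simp add: arcs)
  moreover have "dim (arc_vec ` arcs G) = card {j, k}"
    by (rule dim_arc_vec_connected[of i])
      (use d arc_vec_in_span_arcs[of i j] arc_vec_in_span_arcs[of i k] in \<open>auto simp: arcs\<close>)
  ultimately show ?thesis using d by simp
qed

text \<open>A hexagon.\<close>
lemma degree_eq_dim_cycle_3: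
  assumes "edges G = {{i, j}, {j, k}, {k, i}}" and d: "distinct [i, j, k]"
  shows "card {b. spans_edge G (i, j) b} = dim (arc_vec ` arcs G)"
proof -
  have arcs: "arcs G = {(i, j), (j, i), (j, k), (k, j), (k, i), (i, k)}"
    using assms(1) by (auto simp: arcs_def doubleton_eq_iff)
  have "card {b. spans_edge G (i, j) b} = card {(k, j), (i, k)}"
  proof (rule degree_eqI)
    fix b assume "b \<in> arcs G"
    then consider "b = (i, j)" | "b = (j, i)" | "b = (j, k)" | "b = (k, j)" | "b = (k, i)" | "b = (i, k)"
      by (auto simp: arcs)
    then show "spans_edge G (i, j) b \<longleftrightarrow> b \<in> {(k, j), (i, k)}"
    proof cases
      case 1 then show ?thesis using d by simp
    next
      case 2 then show ?thesis using d not_spans_edge_opposite[of i j j k] by (auto simp: arcs)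
    next
      case 3 then show ?thesis using d spans_edge_consecutive_iff[of i j k] by (auto simp: arcs)
    next
      case 4 then show ?thesis using d spans_edge_common_head[of i j k] by (auto simp: arcs)
    next
      case 5 then show ?thesis
        using d spans_edge_consecutive_iff[of k i j] by (subst spans_edge_commute) (auto simp: arcs)
    next
      case 6 then show ?thesis using d spans_edge_common_tail[of i j k] by (auto simp: arcs)
    qed
  qed (simp add: arcs)
  moreover have "dim (arc_vec ` arcs G) = card {j, k}"
    by (rule dim_arc_vec_connected[of i])
      (use d arc_vec_in_span_arcs[of i j] arc_vec_in_span_arcs[of i k] in \<open>auto simp: arcs\<close>)
  ultimately show ?thesis using d by simp
qed

text \<open>A parallelepiped, with eight vertices of degree 3.\<close>
lemma degree_eq_dim_cycle_4:
  assumes "edges G = {{i, j}, {j, l}, {l, k}, {k, i}}" and d: "distinct [i, j, l, k]"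
  shows "card {b. spans_edge G (i, j) b} = dim (arc_vec ` arcs G)"
proof -
  have arcs: "arcs G = {(i, j), (j, i), (j, l), (l, j), (l, k), (k, l), (k, i), (i, k)}"
    using assms(1) by (auto simp: arcs_def doubleton_eq_iff)
  have "card {b. spans_edge G (i, j) b} = card {(l, j), (k, l), (i, k)}"
  proof (rule degree_eqI)
    fix b assume "b \<in> arcs G"
    then consider "b = (i, j)" | "b = (j, i)" | "b = (j, l)" | "b = (l, j)" | "b = (l, k)"
      | "b = (k, l)" | "b = (k, i)" | "b = (i, k)"
      by (auto simp: arcs)
    then show "spans_edge G (i, j) b \<longleftrightarrow> b \<in> {(l, j), (k, l), (i, k)}"
    proof cases
      case 1 then show ?thesis using d by simp
    next
      case 2 then show ?thesis using d not_spans_edge_opposite[of i j j l] by (auto simp: arcs)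
    next
      case 3 then show ?thesis using d spans_edge_consecutive_iff[of i j l] by (auto simp: arcs)
    next
      case 4 then show ?thesis using d spans_edge_common_head[of i j l] by (auto simp: arcs)
    next
      case 5 then show ?thesis using d spans_edge_disjoint_iff[of i j l k] by (auto simp: arcs)
    next
      case 6 then show ?thesis using d spans_edge_disjoint_iff[of i j k l] by (auto simp: arcs)
    next
      case 7 then show ?thesis
        using d spans_edge_consecutive_iff[of k i j] by (subst spans_edge_commute) (auto simp: arcs)
    next
      case 8 then show ?thesis using d spans_edge_common_tail[of i j k] by (auto simp: arcs)
    qed
  qed (simp add: arcs)
  moreover have "dim (arc_vec ` arcs G) = card {j, l, k}"
    by (rule dim_arc_vec_connected[of i])
      (use d arc_vec_in_span_arcs[of i j] arc_vec_in_span_arcs[of i k]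
        arc_vec_in_span_trans[of i j l] in \<open>auto simp: arcs\<close>)
  ultimately show ?thesis using d by simp
qed

lemma simple_polytope_iff_edges:
  assumes "edges G \<noteq> {}"
  shows "simple_polytope P \<longleftrightarrow>
    (\<exists>a b. a \<noteq> b \<and> edges G = {{a, b}}) \<or>
    (\<exists>a b c d. distinct [a, b, c, d] \<and> edges G = {{a, b}, {c, d}}) \<or>
    (\<exists>a b c. distinct [a, b, c] \<and> edges G = {{a, b}, {b, c}}) \<or>
    (\<exists>a b c. distinct [a, b, c] \<and> edges G = {{a, b}, {b, c}, {c, a}}) \<or>
    (\<exists>a b c d. distinct [a, b, c, d] \<and> edges G = {{a, b}, {b, c}, {c, d}, {d, a}})"
    (is "_ \<longleftrightarrow> ?P1 \<or> ?two_P1 \<or> ?P2 \<or> ?C3 \<or> ?C4")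
proof -
  obtain e where "e \<in> edges G" using assms by blast
  moreover obtain i j where "e = {i, j}"
    using \<open>e \<in> _\<close> by (metis edge_doubleton[OF simple])
  ultimately have ij: "(i, j) \<in> arcs G" by (simp add: arcs_def)
  have *: "simple_polytope P \<longleftrightarrow> (\<forall>a \<in> arcs G. card {b. spans_edge G a b} = dim (arc_vec ` arcs G))"
    using ij by (intro simple_polytope_iff) auto
  show ?thesis
  proof
    assume "simple_polytope P"
    then have "card {b. spans_edge G (i, j) b} = dim (arc_vec ` arcs G)" using * ij by blast
    from ij this show "?P1 \<or> ?two_P1 \<or> ?P2 \<or> ?C3 \<or> ?C4"
    proof (cases rule: edges_if_degree_eq_dim)
      case P1
      then have ?P1 using arc_neq[OF ij] by blast
      then show ?thesis by blast
    next
      case (two_P1 k l)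
      then have ?two_P1 by blast
      then show ?thesis by blast
    next
      case (P2_tail k)
      then have ?P2 by (intro exI[of _ j] exI[of _ i] exI[of _ k]) auto
      then show ?thesis by blast
    next
      case (P2_head k)
      then have ?P2 by blast
      then show ?thesis by blast
    next
      case (C3 k)
      then have ?C3 by blast
      then show ?thesis by blast
    next
      case (C4 k l)
      then have ?C4 by blast
      then show ?thesis by blast
    qed
  next
    assume R: "?P1 \<or> ?two_P1 \<or> ?P2 \<or> ?C3 \<or> ?C4"
    have "card {b. spans_edge G (i, j) b} = dim (arc_vec ` arcs G)" if ij: "(i, j) \<in> arcs G" for i j
    proof -
      have ijE: "{i, j} \<in> edges G" using ij by (simp add: arcs_def)
      note neq = arc_neq[OF ij]
      from R consider ?P1 | ?two_P1 | ?P2 | ?C3 | ?C4 by blast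
      then show ?thesis
      proof cases
        case 1
        then have "edges G = {{i, j}}" using ijE by auto
        then show ?thesis using neq by (rule degree_eq_dim_path_1)
      next
        case 2
        then obtain a b c d where d: "distinct [a, b, c, d]" and E: "edges G = {{a, b}, {c, d}}" by blast
        from ijE E consider "{i, j} = {a, b}" | "{i, j} = {c, d}" by auto
        then have "\<exists>k l. distinct [i, j, k, l] \<and> edges G = {{i, j}, {k, l}}"
        proof cases
          case 1
          then show ?thesis using d E by (intro exI[of _ c] exI[of _ d]) (auto simp: doubleton_eq_iff)
        next
          case 2
          then show ?thesis using d E by (intro exI[of _ a] exI[of _ b]) (auto simp: doubleton_eq_iff)
        qed
        then show ?thesis using degree_eq_dim_two_path_1 by blast
      next
        case 3
        then obtain a b c where d: "distinct [a, b, c]" and E: "edges G = {{a, b}, {b, c}}" by blast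
        then consider "i = b" "j = a" | "i = b" "j = c" | "j = b" "i = a" | "j = b" "i = c"
          using ijE by (auto simp: doubleton_eq_iff)
        then show ?thesis
          using d E degree_eq_dim_path_2_tail[of j i] degree_eq_dim_path_2_head[of i j]
          by cases (auto simp: insert_commute)
      next
        case 4
        then obtain a b c where d: "distinct [a, b, c]" and E: "edges G = {{a, b}, {b, c}, {c, a}}" by blast
        from ijE E consider "{i, j} = {a, b}" | "{i, j} = {b, c}" | "{i, j} = {c, a}" by auto
        then have "\<exists>k. distinct [i, j, k] \<and> edges G = {{i, j}, {j, k}, {k, i}}"
        proof cases
          case 1
          then show ?thesis using d E by (intro exI[of _ c]) (auto simp: doubleton_eq_iff)
        next
          case 2
          then show ?thesis using d E by (intro exI[of _ a]) (auto simp: doubleton_eq_iff)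
        next
          case 3
          then show ?thesis using d E by (intro exI[of _ b]) (auto simp: doubleton_eq_iff)
        qed
        then show ?thesis using degree_eq_dim_cycle_3 by blast
      next
        case 5
        then obtain a b c d where d: "distinct [a, b, c, d]"
          and E: "edges G = {{a, b}, {b, c}, {c, d}, {d, a}}" by blast
        then consider "i = a" "j = b" | "i = b" "j = a" | "i = b" "j = c" | "i = c" "j = b"
          | "i = c" "j = d" | "i = d" "j = c" | "i = d" "j = a" | "i = a" "j = d"
          using ijE by (auto simp: doubleton_eq_iff)
        then have "\<exists>k l. distinct [i, j, l, k] \<and> edges G = {{i, j}, {j, l}, {l, k}, {k, i}}"
        proof cases
          case 1 with d E show ?thesis by (intro exI[of _ d] exI[of _ c]) auto
        next
          case 2 with d E show ?thesis by (intro exI[of _ c] exI[of _ d]) auto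
        next
          case 3 with d E show ?thesis by (intro exI[of _ a] exI[of _ d]) auto
        next
          case 4 with d E show ?thesis by (intro exI[of _ d] exI[of _ a]) auto
        next
          case 5 with d E show ?thesis by (intro exI[of _ b] exI[of _ a]) auto
        next
          case 6 with d E show ?thesis by (intro exI[of _ a] exI[of _ b]) auto
        next
          case 7 with d E show ?thesis by (intro exI[of _ c] exI[of _ b]) auto
        next
          case 8 with d E show ?thesis by (intro exI[of _ b] exI[of _ c]) auto
        qed
        then show ?thesis using degree_eq_dim_cycle_4 by blast
      qed
    qed
    then show "simple_polytope P" using * by auto
  qed
qed

end

section \<open>Isomorphism types as edge sets\<close>

text \<open>Without isolated vertices the edge set determines the vertex set, so an
  injective labelling \<open>g\<close> of the nodes of \<open>H\<close> by nodes of \<open>G\<close> that carries edges onto edges is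
  enough; the isomorphism is the inverse of \<open>g\<close>.\<close>
lemma remove_isolated_isomorphic_iff:
  assumes G: "finite_simple_graph G" and H: "finite_simple_graph H" "verts H = \<Union> (edges H)"
  shows "remove_isolated G \<simeq>\<^sub>g H \<longleftrightarrow> (\<exists>g. inj_on g (verts H) \<and> edges G = (`) g ` edges H)"
proof -
  have V: "verts (remove_isolated G) = \<Union> (edges G)" and E: "edges (remove_isolated G) = edges G"
    using G by (auto simp: remove_isolated_def finite_simple_graph_def)
  show ?thesis
  proof
    assume "remove_isolated G \<simeq>\<^sub>g H"
    then obtain f where f: "bij_betw f (\<Union> (edges G)) (verts H)"
      and "\<forall>u \<in> \<Union> (edges G). \<forall>v \<in> \<Union> (edges G). {u, v} \<in> edges G \<longleftrightarrow> {f u, f v} \<in> edges H"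
      unfolding graph_isomorphic_def V E by (elim exE conjE) (rule that)
    then have adj: "{u, v} \<in> edges G \<longleftrightarrow> {f u, f v} \<in> edges H"
      if "u \<in> \<Union> (edges G)" "v \<in> \<Union> (edges G)" for u v using that by (metis (no_types))
    define g where "g = inv_into (\<Union> (edges G)) f"
    have gf: "g (f u) = u" if "u \<in> \<Union> (edges G)" for u
      using f that by (simp add: g_def bij_betw_inv_into_left)
    have fg: "f (g x) = x" "g x \<in> \<Union> (edges G)" if "x \<in> verts H" for x
      using bij_betw_inv_into_right[OF f that] bij_betwE[OF bij_betw_inv_into[OF f]] that
      by (simp_all add: g_def)
    have "inj_on g (verts H)" by (metis fg(1) inj_onI)
    moreover have "edges G = (`) g ` edges H"
    proof (intro equalityI subsetI)
      fix e assume e: "e \<in> edges G"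
      obtain u v where uv: "e = {u, v}" by (rule edge_doubleton[OF G e])
      then have "u \<in> \<Union> (edges G)" "v \<in> \<Union> (edges G)" using e by auto
      then have "{f u, f v} \<in> edges H" "e = g ` {f u, f v}"
        using adj[of u v] gf e uv by auto
      then show "e \<in> (`) g ` edges H" by blast
    next
      fix e assume "e \<in> (`) g ` edges H"
      then obtain h where h: "h \<in> edges H" "e = g ` h" by blast
      obtain x y where xy: "h = {x, y}" by (rule edge_doubleton[OF H(1) h(1)])
      then have "x \<in> verts H" "y \<in> verts H" using h H(2) by auto
      then have "{g x, g y} \<in> edges G" using adj[of "g x" "g y"] fg h xy by auto
      then show "e \<in> edges G" using h xy by auto
    qed
    ultimately show "\<exists>g. inj_on g (verts H) \<and> edges G = (`) g ` edges H" by blast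
  next
    assume "\<exists>g. inj_on g (verts H) \<and> edges G = (`) g ` edges H"
    then obtain g where g: "inj_on g (verts H)" "edges G = (`) g ` edges H" by blast
    define f where "f = inv_into (verts H) g"
    have VG: "\<Union> (edges G) = g ` verts H" using g(2) H(2) by auto
    have "bij_betw f (\<Union> (edges G)) (verts H)"
      unfolding f_def VG by (intro bij_betw_inv_into bij_betw_imageI g(1) refl)
    moreover have "{u, v} \<in> edges G \<longleftrightarrow> {f u, f v} \<in> edges H"
      if "u \<in> \<Union> (edges G)" "v \<in> \<Union> (edges G)" for u v
    proof -
      obtain x y where xy: "x \<in> verts H" "y \<in> verts H" "u = g x" "v = g y"
        using \<open>u \<in> _\<close> \<open>v \<in> _\<close> VG by auto
      then have f: "f u = x" "f v = y" using g(1) by (simp_all add: f_def)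
      have "{u, v} \<in> edges G \<longleftrightarrow> (\<exists>h \<in> edges H. g ` {x, y} = g ` h)"
        using xy g(2) by auto
      also have "\<dots> \<longleftrightarrow> (\<exists>h \<in> edges H. {x, y} = h)"
      proof (rule bex_cong)
        fix h assume "h \<in> edges H"
        then have "h \<subseteq> verts H" using H(2) by auto
        then show "g ` {x, y} = g ` h \<longleftrightarrow> {x, y} = h"
          using xy by (intro inj_on_image_eq_iff[OF g(1)]) auto
      qed simp
      finally show ?thesis using f by simp
    qed
    ultimately show "remove_isolated G \<simeq>\<^sub>g H"
      unfolding graph_isomorphic_def V E by (intro exI[of _ f] conjI ballI)
  qed
qed

lemma path_graph_1: "path_graph 1 = \<lparr>verts = {0, 1}, edges = {{0, 1}}\<rparr>"
  by (auto simp: path_graph_def)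

lemma path_graph_2: "path_graph 2 = \<lparr>verts = {0, 1, 2}, edges = {{0, 1}, {1, 2}}\<rparr>"
proof -
  have "{0..2} = {0, 1, 2::nat}" by auto
  moreover have "{{i, i + 1} | i. i < (2::nat)} = (\<lambda>i. {i, i + 1}) ` {0, 1}" by force
  ultimately show ?thesis by (simp add: path_graph_def numeral_2_eq_2)
qed

lemma cycle_graph_3: "cycle_graph 3 = \<lparr>verts = {0, 1, 2}, edges = {{0, 1}, {1, 2}, {2, 0}}\<rparr>"
proof -
  have "{0..<3} = {0, 1, 2::nat}" by auto
  moreover have "{{i, (i + 1) mod 3} | i. i < (3::nat)} = (\<lambda>i. {i, (i + 1) mod 3}) ` {0..<3}" by auto
  ultimately show ?thesis by (simp add: cycle_graph_def flip: numeral_2_eq_2)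
qed

lemma cycle_graph_4:
  "cycle_graph 4 = \<lparr>verts = {0, 1, 2, 3}, edges = {{0, 1}, {1, 2}, {2, 3}, {3, 0}}\<rparr>"
proof -
  have "{0..<4} = {0, 1, 2, 3::nat}" by auto
  moreover have "{{i, (i + 1) mod 4} | i. i < (4::nat)} = (\<lambda>i. {i, (i + 1) mod 4}) ` {0..<4}" by auto
  ultimately show ?thesis by (simp add: cycle_graph_def flip: numeral_2_eq_2)
qed

lemma isomorphic_path_1_iff:
  fixes G :: "'a graph"
  assumes "finite_simple_graph G"
  shows "remove_isolated G \<simeq>\<^sub>g path_graph 1 \<longleftrightarrow> (\<exists>a b. a \<noteq> b \<and> edges G = {{a, b}})"
proof -
  let ?g = "\<lambda>g. distinct [g (0::nat), g 1] \<and> edges G = {{g 0, g 1}}"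
  have fin: "finite_simple_graph (path_graph 1)"
    unfolding path_graph_1 by (simp add: finite_simple_graph_def)
  have verts: "verts (path_graph 1) = \<Union> (edges (path_graph 1))"
    unfolding path_graph_1 by (simp only: graph.simps) blast
  have inj: "inj_on g {0, 1} \<longleftrightarrow> distinct [g 0, g 1]" for g :: "nat \<Rightarrow> 'a"
    using distinct_map[of g "[0, 1]"] by simp
  have "remove_isolated G \<simeq>\<^sub>g path_graph 1 \<longleftrightarrow> (\<exists>g. ?g g)"
    using remove_isolated_isomorphic_iff[OF assms fin verts] unfolding path_graph_1
    by (simp only: graph.simps inj image_insert image_empty)
  also have "\<dots> \<longleftrightarrow> (\<exists>a b. a \<noteq> b \<and> edges G = {{a, b}})"
  proof (intro iffI; elim exE)
    fix a b assume "a \<noteq> b \<and> edges G = {{a, b}}"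
    then show "\<exists>g. ?g g"
      by (intro exI[of _ "(!) [a, b]"]) simp
  qed (use distinct_length_2_or_more in auto)
  finally show ?thesis .
qed

lemma isomorphic_two_path_1_iff:
  fixes G :: "'a graph"
  assumes "finite_simple_graph G"
  shows "remove_isolated G \<simeq>\<^sub>g disjoint_union (path_graph 1) (path_graph 1) \<longleftrightarrow>
    (\<exists>a b c d. distinct [a, b, c, d] \<and> edges G = {{a, b}, {c, d}})"
proof -
  let ?g = "\<lambda>g. distinct [g (Inl (0::nat)), g (Inl 1), g (Inr (0::nat)), g (Inr 1)] \<and>
    edges G = {{g (Inl 0), g (Inl 1)}, {g (Inr 0), g (Inr 1)}}"
  let ?H = "disjoint_union (path_graph 1) (path_graph 1)"
  have H_eq: "?H = \<lparr>verts = {Inl 0, Inl 1, Inr 0, Inr 1}, edges = {{Inl 0, Inl 1}, {Inr 0, Inr 1}}\<rparr>"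
    unfolding path_graph_1 disjoint_union_def
    by (simp only: graph.simps Plus_def image_insert image_empty)
      (simp only: Un_insert_left Un_empty_left)
  have fin: "finite_simple_graph ?H"
    unfolding H_eq by (simp add: finite_simple_graph_def)
  have verts: "verts ?H = \<Union> (edges ?H)"
    unfolding H_eq by (simp only: graph.simps) blast
  have inj: "inj_on g {Inl 0, Inl 1, Inr 0, Inr 1} \<longleftrightarrow>
      distinct [g (Inl 0), g (Inl 1), g (Inr 0), g (Inr 1)]" for g :: "nat + nat \<Rightarrow> 'a"
    using distinct_map[of g "[Inl 0, Inl 1, Inr 0, Inr 1]"] by simp
  have "remove_isolated G \<simeq>\<^sub>g ?H \<longleftrightarrow> (\<exists>g. ?g g)"
    using remove_isolated_isomorphic_iff[OF assms fin verts] unfolding H_eq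
    by (simp only: graph.simps inj image_insert image_empty)
  also have "\<dots> \<longleftrightarrow> (\<exists>a b c d. distinct [a, b, c, d] \<and> edges G = {{a, b}, {c, d}})"
  proof (intro iffI; elim exE)
    fix a b c d assume "distinct [a, b, c, d] \<and> edges G = {{a, b}, {c, d}}"
    then show "\<exists>g. ?g g"
      by (intro exI[of _ "case_sum ((!) [a, b]) ((!) [c, d])"]) simp
  qed blast
  finally show ?thesis .
qed

lemma isomorphic_path_2_iff:
  fixes G :: "'a graph"
  assumes "finite_simple_graph G"
  shows "remove_isolated G \<simeq>\<^sub>g path_graph 2 \<longleftrightarrow>
    (\<exists>a b c. distinct [a, b, c] \<and> edges G = {{a, b}, {b, c}})"
proof -
  let ?g = "\<lambda>g. distinct [g (0::nat), g 1, g 2] \<and> edges G = {{g 0, g 1}, {g 1, g 2}}"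
  have fin: "finite_simple_graph (path_graph 2)"
    unfolding path_graph_2 by (simp add: finite_simple_graph_def)
  have verts: "verts (path_graph 2) = \<Union> (edges (path_graph 2))"
    unfolding path_graph_2 by (simp only: graph.simps) blast
  have inj: "inj_on g {0, 1, 2} \<longleftrightarrow> distinct [g 0, g 1, g 2]" for g :: "nat \<Rightarrow> 'a"
    using distinct_map[of g "[0, 1, 2]"] by simp
  have "remove_isolated G \<simeq>\<^sub>g path_graph 2 \<longleftrightarrow> (\<exists>g. ?g g)"
    using remove_isolated_isomorphic_iff[OF assms fin verts] unfolding path_graph_2
    by (simp only: graph.simps inj image_insert image_empty)
  also have "\<dots> \<longleftrightarrow> (\<exists>a b c. distinct [a, b, c] \<and> edges G = {{a, b}, {b, c}})"
  proof (intro iffI; elim exE)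
    fix a b c assume "distinct [a, b, c] \<and> edges G = {{a, b}, {b, c}}"
    then show "\<exists>g. ?g g" by (intro exI[of _ "(!) [a, b, c]"]) simp
  qed blast
  finally show ?thesis .
qed

lemma isomorphic_cycle_3_iff:
  fixes G :: "'a graph"
  assumes "finite_simple_graph G"
  shows "remove_isolated G \<simeq>\<^sub>g cycle_graph 3 \<longleftrightarrow>
    (\<exists>a b c. distinct [a, b, c] \<and> edges G = {{a, b}, {b, c}, {c, a}})"
proof -
  let ?g = "\<lambda>g. distinct [g (0::nat), g 1, g 2] \<and> edges G = {{g 0, g 1}, {g 1, g 2}, {g 2, g 0}}"
  have fin: "finite_simple_graph (cycle_graph 3)"
    unfolding cycle_graph_3 by (simp add: finite_simple_graph_def)
  have verts: "verts (cycle_graph 3) = \<Union> (edges (cycle_graph 3))"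
    unfolding cycle_graph_3 by (simp only: graph.simps) blast
  have inj: "inj_on g {0, 1, 2} \<longleftrightarrow> distinct [g 0, g 1, g 2]" for g :: "nat \<Rightarrow> 'a"
    using distinct_map[of g "[0, 1, 2]"] by simp
  have "remove_isolated G \<simeq>\<^sub>g cycle_graph 3 \<longleftrightarrow> (\<exists>g. ?g g)"
    using remove_isolated_isomorphic_iff[OF assms fin verts] unfolding cycle_graph_3
    by (simp only: graph.simps inj image_insert image_empty)
  also have "\<dots> \<longleftrightarrow> (\<exists>a b c. distinct [a, b, c] \<and> edges G = {{a, b}, {b, c}, {c, a}})"
  proof (intro iffI; elim exE)
    fix a b c assume "distinct [a, b, c] \<and> edges G = {{a, b}, {b, c}, {c, a}}"
    then show "\<exists>g. ?g g" by (intro exI[of _ "(!) [a, b, c]"]) simp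
  qed blast
  finally show ?thesis .
qed

lemma isomorphic_cycle_4_iff:
  fixes G :: "'a graph"
  assumes "finite_simple_graph G"
  shows "remove_isolated G \<simeq>\<^sub>g cycle_graph 4 \<longleftrightarrow>
    (\<exists>a b c d. distinct [a, b, c, d] \<and> edges G = {{a, b}, {b, c}, {c, d}, {d, a}})"
proof -
  let ?g = "\<lambda>g. distinct [g (0::nat), g 1, g 2, g 3] \<and>
    edges G = {{g 0, g 1}, {g 1, g 2}, {g 2, g 3}, {g 3, g 0}}"
  have fin: "finite_simple_graph (cycle_graph 4)"
    unfolding cycle_graph_4 by (simp add: finite_simple_graph_def)
  have verts: "verts (cycle_graph 4) = \<Union> (edges (cycle_graph 4))"
    unfolding cycle_graph_4 by (simp only: graph.simps) blast
  have inj: "inj_on g {0, 1, 2, 3} \<longleftrightarrow> distinct [g 0, g 1, g 2, g 3]" for g :: "nat \<Rightarrow> 'a"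
    using distinct_map[of g "[0, 1, 2, 3]"] by simp
  have "remove_isolated G \<simeq>\<^sub>g cycle_graph 4 \<longleftrightarrow> (\<exists>g. ?g g)"
    using remove_isolated_isomorphic_iff[OF assms fin verts] unfolding cycle_graph_4
    by (simp only: graph.simps inj image_insert image_empty)
  also have "\<dots> \<longleftrightarrow> (\<exists>a b c d. distinct [a, b, c, d] \<and> edges G = {{a, b}, {b, c}, {c, d}, {d, a}})"
  proof (intro iffI; elim exE)
    fix a b c d assume "distinct [a, b, c, d] \<and> edges G = {{a, b}, {b, c}, {c, d}, {d, a}}"
    then show "\<exists>g. ?g g" by (intro exI[of _ "(!) [a, b, c, d]"]) simp
  qed blast
  finally show ?thesis .
qed

theorem proposition2p3:
  fixes G :: "'n::finite graph"
  assumes "finite_simple_graph G"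
    and "verts G = UNIV"
    and "edges G \<noteq> {}"
  shows "simple_polytope (symmetric_edge_polytope G) \<longleftrightarrow>
      remove_isolated G \<simeq>\<^sub>g path_graph 1 \<or>
      remove_isolated G \<simeq>\<^sub>g disjoint_union (path_graph 1) (path_graph 1) \<or>
      remove_isolated G \<simeq>\<^sub>g path_graph 2 \<or>
      remove_isolated G \<simeq>\<^sub>g cycle_graph 3 \<or>
      remove_isolated G \<simeq>\<^sub>g cycle_graph 4"
proof -
  interpret simple_graph G by standard (rule assms(1))
  show ?thesis
    unfolding isomorphic_path_1_iff[OF assms(1)] isomorphic_two_path_1_iff[OF assms(1)]
      isomorphic_path_2_iff[OF assms(1)] isomorphic_cycle_3_iff[OF assms(1)]
      isomorphic_cycle_4_iff[OF assms(1)]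
    by (rule simple_polytope_iff_edges[OF assms(3)])
qed

end
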